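(* For every integer $n\ge 1$, $|\mathcal{SS}_2(n)|\ge \binom{2n}{n}$, and the inequality is strict if $n\ge 3$.
   Context: A binary word $s=s_1s_2\cdots s_{2n}\in\{0,1\}^{2n}$ is a shuffle square if there exist disjoint index sets $I=\{i_1<\cdots<i_n\}$ and $J=\{j_1<\cdots<j_n\}$ contained in $\{1,\dots,2n\}$ (so that they partition $\{1,\dots,2n\}$) with $s_{i_r}=s_{j_r}$ for all $1\le r\le n$. $\mathcal{SS}_2(n)$ denotes the set of all shuffle squares in $\{0,1\}^{2n}$. *)

theory Defs
  imports Complex_Main
begin

text \<open>
  Binary words are lists over \<^typ>\<open>bool\<close> (\<^term>\<open>False\<close> for 0, \<^term>\<open>True\<close> for 1). Positions are counted
  from 0, and the index sets $I$ and $J$ are given by their increasing enumerations \<open>i\<close> and \<open>j\<close>.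
\<close>

definition shuffle_square :: "nat \<Rightarrow> 'a list \<Rightarrow> bool" where
  "shuffle_square n s \<longleftrightarrow>
     length s = 2 * n \<and>
     (\<exists>i j :: nat \<Rightarrow> nat.
        strict_mono_on {..<n} i \<and> strict_mono_on {..<n} j \<and>
        i ` {..<n} \<subseteq> {..<2 * n} \<and> j ` {..<n} \<subseteq> {..<2 * n} \<and>
        i ` {..<n} \<inter> j ` {..<n} = {} \<and>
        (\<forall>r<n. s ! i r = s ! j r))"

definition SS2 :: "nat \<Rightarrow> bool list set" where
  "SS2 n = {s. shuffle_square n s}"

end

(* Scan a word with a queue: each letter is either appended to the queue or, if it equals the
   front letter, removes it. The words that can empty the queue are the shuffle squares (the
   appended letters form I, the removing ones J). The greedy strategy removes whenever it can. For
   binary words it has, at a nonempty queue, exactly one letter for each of the two moves, while at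
   the empty queue both letters are appended. The queue length thus runs through Dyck paths, and a
   path with k returns to zero comes from 2^k words. Choosing a sign for each excursion, the words
   whose greedy scan empties the queue are equinumerous with the closed +1/-1 walks of length 2n,
   which gives the binomial coefficient. The word 001001 is a square on which the greedy scan does
   not end with an empty queue; prefixed with zeros it gives strictness. *)
theory Submission
  imports Defs
begin

text \<open>\<open>p\<close> is the prefix read so far and \<open>q\<close> the queue, front at the
  head. The scan is nondeterministic: \<open>push\<close> is allowed even when the letter equals the
  front.\<close>

inductive queue_scan :: "'a list \<Rightarrow> 'a list \<Rightarrow> bool" where
  empty: "queue_scan [] []"
| push: "queue_scan p q \<Longrightarrow> queue_scan (p @ [c]) (q @ [c])"
| pop: "queue_scan p (c # q) \<Longrightarrow> queue_scan (p @ [c]) q"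

lemma strict_mono_on_fun_upd:
  fixes f :: "nat \<Rightarrow> nat"
  assumes "strict_mono_on {..<a} f" "f ` {..<a} \<subseteq> {..<m}"
  shows "strict_mono_on {..<Suc a} (f(a := m))"
  using assms unfolding strict_mono_on_def by (auto simp: less_Suc_eq)

lemma fun_upd_image_lessThan_Suc:
  fixes f :: "nat \<Rightarrow> 'a"
  shows "(f(a := m)) ` {..<Suc a} = insert m (f ` {..<a})"
  by (auto simp: less_Suc_eq)

text \<open>The invariant of the scan: \<open>i\<close> lists the pushing positions,
  \<open>j\<close> the removing ones. As the queue is first-in first-out, removal number
  \<open>r\<close> meets the letter of push number \<open>r\<close>, and the queue holds the letters
  of pushes \<open>b\<close> to \<open>a - 1\<close>.\<close>

lemma queue_scan_index_sets:
  assumes "queue_scan p q"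
  shows "\<exists>i j a b. strict_mono_on {..<a} i \<and> strict_mono_on {..<b} j \<and>
           i ` {..<a} \<subseteq> {..<length p} \<and> j ` {..<b} \<subseteq> {..<length p} \<and>
           i ` {..<a} \<inter> j ` {..<b} = {} \<and>
           a = b + length q \<and> a + b = length p \<and>
           (\<forall>r<b. p ! i r = p ! j r) \<and> (\<forall>r<length q. p ! i (b + r) = q ! r)"
  using assms
proof induction
  case empty
  show ?case by (auto simp: strict_mono_on_def)
next
  case (push p q c)
  then obtain i j a b where h: "strict_mono_on {..<a} i" "strict_mono_on {..<b} j"
    "i ` {..<a} \<subseteq> {..<length p}" "j ` {..<b} \<subseteq> {..<length p}"
    "i ` {..<a} \<inter> j ` {..<b} = {}" "a = b + length q" "a + b = length p"
    "\<forall>r<b. p ! i r = p ! j r" "\<forall>r<length q. p ! i (b + r) = q ! r"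
    by (elim exE conjE)
  let ?i = "i(a := length p)"
  have lt: "i r < length p" if "r < a" for r using h(3) that by auto
  have ltj: "j r < length p" if "r < b" for r using h(4) that by auto
  have img: "?i ` {..<Suc a} = insert (length p) (i ` {..<a})"
    by (rule fun_upd_image_lessThan_Suc)
  have "strict_mono_on {..<Suc a} ?i" by (rule strict_mono_on_fun_upd[OF h(1,3)])
  moreover have "?i ` {..<Suc a} \<subseteq> {..<length (p @ [c])}"
    unfolding img using h(3) by auto
  moreover have "j ` {..<b} \<subseteq> {..<length (p @ [c])}" using h(4) by auto
  moreover have "?i ` {..<Suc a} \<inter> j ` {..<b} = {}"
    unfolding img using h(4,5) by auto
  moreover have "\<forall>r<b. (p @ [c]) ! ?i r = (p @ [c]) ! j r"
    using h(6,8) lt ltj by (auto simp: nth_append)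
  moreover have "\<forall>r<length (q @ [c]). (p @ [c]) ! ?i (b + r) = (q @ [c]) ! r"
    using h(6,9) lt by (auto simp: nth_append less_Suc_eq)
  moreover have "Suc a = b + length (q @ [c])" "Suc a + b = length (p @ [c])" using h(6,7) by auto
  ultimately show ?case using h(2) by blast
next
  case (pop p c q)
  then obtain i j a b where h: "strict_mono_on {..<a} i" "strict_mono_on {..<b} j"
    "i ` {..<a} \<subseteq> {..<length p}" "j ` {..<b} \<subseteq> {..<length p}"
    "i ` {..<a} \<inter> j ` {..<b} = {}" "a = b + length (c # q)" "a + b = length p"
    "\<forall>r<b. p ! i r = p ! j r" "\<forall>r<length (c # q). p ! i (b + r) = (c # q) ! r"
    by (elim exE conjE)
  let ?j = "j(b := length p)"
  have lt: "i r < length p" if "r < a" for r using h(3) that by auto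
  have ltj: "j r < length p" if "r < b" for r using h(4) that by auto
  have img: "?j ` {..<Suc b} = insert (length p) (j ` {..<b})"
    by (rule fun_upd_image_lessThan_Suc)
  have "strict_mono_on {..<Suc b} ?j" by (rule strict_mono_on_fun_upd[OF h(2,4)])
  moreover have "i ` {..<a} \<subseteq> {..<length (p @ [c])}" using h(3) by auto
  moreover have "?j ` {..<Suc b} \<subseteq> {..<length (p @ [c])}"
    unfolding img using h(4) by auto
  moreover have "i ` {..<a} \<inter> ?j ` {..<Suc b} = {}"
    unfolding img using h(3,5) by auto
  \<comment> \<open>Push number \<open>b\<close> is the oldest one still in the queue, so it is the
    partner of the new removal.\<close>
  moreover have "p ! i b = c" using h(9) by force
  then have "\<forall>r<Suc b. (p @ [c]) ! i r = (p @ [c]) ! ?j r"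
    using h(6,8) lt ltj by (auto simp: nth_append less_Suc_eq)
  moreover have "(p @ [c]) ! i (Suc b + r) = q ! r" if "r < length q" for r
    using h(9)[rule_format, of "Suc r"] h(6) lt[of "Suc b + r"] that by (simp add: nth_append)
  moreover have "a = Suc b + length q" "a + Suc b = length (p @ [c])" using h(6,7) by auto
  ultimately show ?case using h(1) by blast
qed

lemma shuffle_square_if_queue_scan:
  assumes "queue_scan s []" "length s = 2 * n"
  shows "shuffle_square n s"
proof -
  obtain i j a b where h: "strict_mono_on {..<a} i" "strict_mono_on {..<b} j"
    "i ` {..<a} \<subseteq> {..<length s}" "j ` {..<b} \<subseteq> {..<length s}"
    "i ` {..<a} \<inter> j ` {..<b} = {}" "a = b" "a + b = length s"
    "\<forall>r<b. s ! i r = s ! j r"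
    using queue_scan_index_sets[OF assms(1)] by auto
  have eq: "a = n" "b = n" using h(6,7) assms(2) by auto
  show ?thesis
    unfolding shuffle_square_def using h(1-5,8)[unfolded eq assms(2)] assms(2) by blast
qed

definition greedy_step :: "'a list \<Rightarrow> 'a \<Rightarrow> 'a list" where
  "greedy_step q c = (if q \<noteq> [] \<and> hd q = c then tl q else q @ [c])"

lemma queue_scan_greedy: "queue_scan w (foldl greedy_step [] w)"
proof (induction w rule: rev_induct)
  case Nil
  show ?case by (simp add: queue_scan.empty)
next
  case (snoc c w)
  show ?case
  proof (cases "foldl greedy_step [] w")
    case Nil
    then show ?thesis using queue_scan.push[OF snoc, of c] by (simp add: greedy_step_def[of "[]"])
  next
    case (Cons d q)
    then show ?thesis
      using queue_scan.push[OF snoc, of c] queue_scan.pop[of w d q] snoc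
      by (auto simp: greedy_step_def[of "d # q"])
  qed
qed

definition greedy_words :: "nat \<Rightarrow> bool list \<Rightarrow> bool list set" where
  "greedy_words m q = {w. length w = m \<and> foldl greedy_step q w = []}"

lemma finite_bool_lists: "finite {w :: bool list. length w = m}"
  using finite_lists_length_eq[of "UNIV :: bool set" m] by simp

text \<open>Split by the first letter. Leaving \<open>x\<close> free lets it be the front letter of
  \<open>q\<close> later.\<close>

lemma card_greedy_words_Suc:
  "card (greedy_words (Suc m) q) =
     card (greedy_words m (greedy_step q x)) + card (greedy_words m (greedy_step q (\<not> x)))"
proof -
  have fin: "finite (greedy_words m q')" for q'
    unfolding greedy_words_def by (rule finite_subset[OF _ finite_bool_lists[of m]]) auto
  have "greedy_words (Suc m) q =
      (#) x ` greedy_words m (greedy_step q x) \<union> (#) (\<not> x) ` greedy_words m (greedy_step q (\<not> x))"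
    unfolding greedy_words_def
    by (cases x) (auto simp: length_Suc_conv image_iff, (metis (full_types))+)
  also have "card \<dots> = card ((#) x ` greedy_words m (greedy_step q x)) +
      card ((#) (\<not> x) ` greedy_words m (greedy_step q (\<not> x)))"
    using fin by (intro card_Un_disjoint) auto
  finally show ?thesis by (simp add: card_image)
qed

text \<open>Only the length of \<open>q\<close> matters: the count is that of +1/-1 walks with
  \<open>m\<close> steps from height \<open>length q\<close> to 0, of which \<open>k\<close> go
  down. For nonempty \<open>q\<close> the recursion is Pascal's rule.\<close>

lemma card_greedy_words:
  assumes "m + length q = 2 * k"
  shows "card (greedy_words m q) = m choose k"
  using assms
proof (induction m arbitrary: q k)
  case 0
  have "greedy_words 0 q = (if q = [] then {[]} else {})"
    by (auto simp: greedy_words_def)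
  then show ?case using 0 by (cases k) auto
next
  case (Suc m)
  show ?case
  proof (cases q)
    case Nil
    then obtain l where l: "k = Suc l" "m = Suc (2 * l)"
      using Suc.prems by (cases k) auto
    have "card (greedy_words m [x]) = m choose k" for x
      using Suc.IH[of "[x]" k] Suc.prems Nil by simp
    then have "card (greedy_words (Suc m) q) = (m choose k) + (m choose k)"
      using card_greedy_words_Suc[of m q True] Nil by (simp add: greedy_step_def)
    \<comment> \<open>Both letters lead to a queue of length 1. Since \<open>m\<close> is odd, its
      two middle coefficients agree, and twice one of them is again the Pascal sum.\<close>
    also have "m choose k = m choose l"
      using binomial_symmetric[of k m] l by simp
    finally show ?thesis using l \<open>m choose k = m choose l\<close> by simp
  next
    case (Cons x q')
    then obtain l where l: "k = Suc l" using Suc.prems by (cases k) auto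
    have "card (greedy_words m q') = m choose l" "card (greedy_words m (q @ [\<not> x])) = m choose k"
      using Suc.prems Cons l by (auto intro!: Suc.IH)
    then show ?thesis
      using card_greedy_words_Suc[of m q x] Cons l by (simp add: greedy_step_def)
  qed
qed

lemma greedy_words_subset_SS2: "greedy_words (2 * n) [] \<subseteq> SS2 n"
proof
  fix w :: "bool list"
  assume "w \<in> greedy_words (2 * n) []"
  then show "w \<in> SS2 n"
    using shuffle_square_if_queue_scan[of w n] queue_scan_greedy[of w]
    by (simp add: greedy_words_def SS2_def)
qed

lemma foldl_greedy_step_replicate:
  "foldl greedy_step [] (replicate (2 * k) c) = []"
  by (induction k) (simp_all add: greedy_step_def)

lemma non_greedy_shuffle_square:
  assumes "n \<ge> 3"
  shows "\<exists>w \<in> SS2 n. w \<notin> greedy_words (2 * n) []"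
proof -
  define z where "z = replicate (2 * (n - 3)) False"
  define w where "w = z @ [False, False, True, False, False, True]"
  have g: "foldl greedy_step [] z = []" by (simp add: z_def foldl_greedy_step_replicate)
  have "queue_scan z []" using queue_scan_greedy[of z] g by simp
  \<comment> \<open>The second 0 is pushed although it could remove the first.\<close>
  then have "queue_scan (z @ [False, False, True]) [False, False, True]"
    using queue_scan.push[OF queue_scan.push[OF queue_scan.push], of z "[]" False False True] by simp
  then have "queue_scan w []"
    unfolding w_def using queue_scan.pop[OF queue_scan.pop[OF queue_scan.pop]] by fastforce
  moreover have "length w = 2 * n" using assms by (simp add: w_def z_def)
  ultimately have "w \<in> SS2 n" by (simp add: SS2_def shuffle_square_if_queue_scan)
  \<comment> \<open>Here the second 0 removes the first, and the scan ends with queue 00.\<close>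
  moreover have "foldl greedy_step [] w \<noteq> []"
    by (simp add: w_def g greedy_step_def)
  ultimately show ?thesis by (auto simp: greedy_words_def)
qed

theorem theorem1p3:
  fixes n :: nat
  assumes "n \<ge> 1"
  shows "card (SS2 n) \<ge> (2 * n) choose n \<and>
         (n \<ge> 3 \<longrightarrow> card (SS2 n) > (2 * n) choose n)"
proof -
  have fin: "finite (SS2 n)"
    unfolding SS2_def shuffle_square_def
    by (rule finite_subset[OF _ finite_bool_lists[of "2 * n"]]) auto
  have card: "card (greedy_words (2 * n) []) = (2 * n) choose n"
    by (rule card_greedy_words) simp
  have "greedy_words (2 * n) [] \<subset> SS2 n" if "n \<ge> 3"
    using non_greedy_shuffle_square[OF that] greedy_words_subset_SS2 by blast
  then show ?thesis
    using card_mono[OF fin greedy_words_subset_SS2] psubset_card_mono[OF fin] card by metis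
qed

end
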